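(* Let $k\geq 2$ be an integer. If $G$ is a non-complete graph of order $n$ with minimum degree $\delta(G)\geq \frac{n}{2}-1+\log_{k} n$, then $rc(G)\leq k$.
   Context: All graphs are finite, undirected and simple; the order of a graph is its number of vertices; $\log_b$ denotes the logarithm to base $b$. A graph is non-complete if it has two distinct non-adjacent vertices. An edge-coloring of $G$ is a function from its edge set to the natural numbers (adjacent edges may receive the same color). An edge-colored graph is rainbow connected if every two distinct vertices are joined by a path whose edges have pairwise distinct colors. The rainbow connection number $rc(G)$ of a connected graph $G$ is the smallest number of colors needed in an edge-coloring that makes $G$ rainbow connected. Thus $rc(G)\leq k$ means that there is an edge-coloring of $G$ with at most $k$ colors making $G$ rainbow connected. *)

theory Defs
  imports Complex_Main "HOL-Library.Extended_Nat"
begin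

text \<open>
  Finite simple undirected graphs, given by a vertex set and a set of edges, where an edge is
  an unordered pair, that is, a two-element set of vertices.
\<close>

locale simple_graph =
  fixes V :: "'a set" and E :: "'a set set"
  assumes finite_vertices: "finite V"
    and edges_wf: "e \<in> E \<Longrightarrow> e \<subseteq> V \<and> card e = 2"

definition noncomplete :: "'a set \<Rightarrow> 'a set set \<Rightarrow> bool" where
  "noncomplete V E \<longleftrightarrow> (\<exists>u\<in>V. \<exists>v\<in>V. u \<noteq> v \<and> {u, v} \<notin> E)"

definition degree :: "'a set \<Rightarrow> 'a set set \<Rightarrow> 'a \<Rightarrow> nat" where
  "degree V E v = card {w \<in> V. {v, w} \<in> E}"

text \<open>The minimum degree is meaningful only for \<open>V\<close> finite and nonempty.\<close>

definition min_degree :: "'a set \<Rightarrow> 'a set set \<Rightarrow> nat" where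
  "min_degree V E = Min (degree V E ` V)"

text \<open>A path is represented by the list of its vertices, which must be pairwise distinct.\<close>

definition path_edges :: "'a list \<Rightarrow> 'a set list" where
  "path_edges p = map (\<lambda>(x, y). {x, y}) (zip p (tl p))"

definition is_path :: "'a set \<Rightarrow> 'a set set \<Rightarrow> 'a \<Rightarrow> 'a list \<Rightarrow> 'a \<Rightarrow> bool" where
  "is_path V E u p v \<longleftrightarrow>
     p \<noteq> [] \<and> hd p = u \<and> last p = v \<and> distinct p \<and> set p \<subseteq> V \<and> set (path_edges p) \<subseteq> E"

text \<open>
  An edge-coloring is a function \<open>c :: 'a set \<Rightarrow> nat\<close> of which only the values on \<open>E\<close> matter;
  it need not be proper.
\<close>

definition rainbow_connected :: "'a set \<Rightarrow> 'a set set \<Rightarrow> ('a set \<Rightarrow> nat) \<Rightarrow> bool" where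
  "rainbow_connected V E c \<longleftrightarrow>
     (\<forall>u\<in>V. \<forall>v\<in>V. u \<noteq> v \<longrightarrow> (\<exists>p. is_path V E u p v \<and> distinct (map c (path_edges p))))"

text \<open>
  The value is \<open>\<infinity>\<close> exactly if no coloring makes the graph rainbow connected, which for
  finite graphs means that the graph is disconnected. In particular
  \<open>rainbow_connection_number V E \<le> enat k\<close> includes connectedness.
\<close>

definition rainbow_connection_number :: "'a set \<Rightarrow> 'a set set \<Rightarrow> enat" where
  "rainbow_connection_number V E =
     (INF c \<in> {c. rainbow_connected V E c}. enat (card (c ` E)))"

lemma rainbow_connection_number_le_iff:
  "rainbow_connection_number V E \<le> enat k \<longleftrightarrow>
     (\<exists>c. rainbow_connected V E c \<and> card (c ` E) \<le> k)"
proof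
  let ?S = "(\<lambda>c. enat (card (c ` E))) ` {c. rainbow_connected V E c}"
  assume le: "rainbow_connection_number V E \<le> enat k"
  then have "?S \<noteq> {}"
    unfolding rainbow_connection_number_def by (metis Inf_enat_def enat_ord_code(5))
  then have "Inf ?S \<in> ?S"
    unfolding Inf_enat_def by (metis LeastI ex_in_conv)
  with le show "\<exists>c. rainbow_connected V E c \<and> card (c ` E) \<le> k"
    by (auto simp: rainbow_connection_number_def)
next
  assume "\<exists>c. rainbow_connected V E c \<and> card (c ` E) \<le> k"
  then show "rainbow_connection_number V E \<le> enat k"
    by (auto simp: rainbow_connection_number_def intro!: INF_lower2)
qed

end

theory Submission
  imports Defs "HOL-Library.FuncSet"
begin

text \<open>
  The proof is a first-moment argument. Two non-adjacent vertices \<open>u\<close> and \<open>v\<close> have both of their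
  neighborhoods inside the \<open>n - 2\<close> remaining vertices, so inclusion-exclusion gives at least
  \<open>2 \<delta> - (n - 2) \<ge> 2 log\<^sub>k n\<close> common neighbors (\<open>card_common_neighbors\<close>). Each common neighbor \<open>w\<close>
  offers a path \<open>u, w, v\<close>, and these paths are pairwise edge-disjoint. If every edge
  independently receives a uniformly random color among \<open>k\<close>, then each such path is monochromatic
  with probability \<open>1 / k\<close>, so all of them fail to be rainbow with probability at most
  \<open>k powr (- 2 log\<^sub>k n) = 1 / n\<^sup>2\<close>. There are fewer than \<open>n\<^sup>2\<close> ordered pairs of distinct vertices,
  hence by the union bound some coloring leaves a rainbow path of length two between any two
  non-adjacent vertices, while adjacent vertices are joined by their edge.

  Probabilities are expressed by counting the functions from \<open>E\<close> to \<open>{..<k}\<close>; the estimate for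
  one pair is \<open>card_PiE_agreeing\<close>, and the union bound is \<open>exists_avoiding_all\<close>.
\<close>

text \<open>
  The values at the points \<open>f w\<close> are forced by those at the points \<open>g w\<close>, which lie outside
  \<open>f ` W\<close>. So a function satisfying all the equations is determined by its restriction to
  \<open>A - f ` W\<close>, and \<open>card W\<close> free choices are lost.
\<close>

lemma card_PiE_agreeing:
  assumes "finite A" "finite K"
    and inj: "inj_on f W" and f: "f ` W \<subseteq> A" and g: "g ` W \<subseteq> A"
    and disj: "f ` W \<inter> g ` W = {}"
  shows "card {c \<in> A \<rightarrow>\<^sub>E K. \<forall>w\<in>W. c (f w) = c (g w)} * card K ^ card W \<le> card K ^ card A"
proof -
  let ?B = "{c \<in> A \<rightarrow>\<^sub>E K. \<forall>w\<in>W. c (f w) = c (g w)}"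
  let ?A = "A - f ` W"
  have "inj_on (\<lambda>c. restrict c ?A) ?B"
  proof (rule inj_onI)
    fix c d assume c: "c \<in> ?B" and d: "d \<in> ?B" and eq: "restrict c ?A = restrict d ?A"
    have *: "c x = d x" if "x \<in> ?A" for x
      using fun_cong[OF eq, of x] that by simp
    have "c x = d x" if "x \<in> A" for x
    proof (cases "x \<in> f ` W")
      case True
      then obtain w where w: "w \<in> W" "x = f w" by blast
      then have "g w \<in> ?A" using g disj by blast
      with * w c d show ?thesis by auto
    qed (use * that in blast)
    then show "c = d"
      using c d by (intro PiE_ext[of c A "\<lambda>_. K" d]) auto
  qed
  moreover have "(\<lambda>c. restrict c ?A) ` ?B \<subseteq> ?A \<rightarrow>\<^sub>E K" by auto
  moreover have "finite (?A \<rightarrow>\<^sub>E K)" using assms(1,2) by (intro finite_PiE) auto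
  ultimately have "card ?B \<le> card (?A \<rightarrow>\<^sub>E K)" by (rule card_inj_on_le)
  also have "\<dots> = card K ^ card ?A" using assms(1) by (simp add: card_PiE)
  finally have "card ?B * card K ^ card W \<le> card K ^ card ?A * card K ^ card W" by simp
  moreover have "card ?A + card W = card A"
    using f assms(1) card_mono[OF assms(1) f]
    by (simp add: card_Diff_subset finite_subset card_image[OF inj])
  ultimately show ?thesis by (simp flip: power_add)
qed

text \<open>
  This is the union bound: fewer than \<open>N\<close> sets of density at most \<open>1 / N\<close> cannot cover \<open>\<Omega>\<close>.
\<close>

lemma exists_avoiding_all:
  fixes N :: nat
  assumes "finite \<Omega>" "\<Omega> \<noteq> {}" "finite I" "card I < N"
    and B: "\<And>i. i \<in> I \<Longrightarrow> B i \<subseteq> \<Omega> \<and> N * card (B i) \<le> card \<Omega>"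
  shows "\<exists>\<omega>\<in>\<Omega>. \<forall>i\<in>I. \<omega> \<notin> B i"
proof (rule ccontr)
  assume "\<not> ?thesis"
  then have "\<Omega> = (\<Union>i\<in>I. B i)" using B by blast
  then have "card \<Omega> \<le> (\<Sum>i\<in>I. card (B i))" using card_UN_le[OF \<open>finite I\<close>] by metis
  then have "N * card \<Omega> \<le> (\<Sum>i\<in>I. N * card (B i))" by (simp flip: sum_distrib_left)
  also have "\<dots> \<le> card I * card \<Omega>" using B sum_bounded_above[of I _ "card \<Omega>"] by fastforce
  finally show False using assms by (simp add: card_gt_0_iff)
qed

context simple_graph
begin

lemma finite_edges: "finite E"
  by (rule finite_subset[of E "Pow V"]) (use edges_wf finite_vertices in auto)

lemma edge_neq: "{u, v} \<in> E \<Longrightarrow> u \<noteq> v"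
  using edges_wf[of "{u, v}"] by auto

lemma card_common_neighbors:
  assumes "u \<in> V" "v \<in> V" "u \<noteq> v" "{u, v} \<notin> E"
  shows "2 * min_degree V E + 2 \<le> card V + card {w \<in> V. {u, w} \<in> E \<and> {v, w} \<in> E}"
proof -
  let ?N = "\<lambda>x. {w \<in> V. {x, w} \<in> E}"
  have "min_degree V E \<le> card (?N x)" if "x \<in> V" for x
    using that finite_vertices unfolding min_degree_def by (auto simp: degree_def intro: Min_le)
  from this[of u] this[of v] have "2 * min_degree V E \<le> card (?N u) + card (?N v)"
    using assms by linarith
  also have "\<dots> = card (?N u \<union> ?N v) + card (?N u \<inter> ?N v)"
    using finite_vertices by (intro card_Un_Int) auto
  also have "?N u \<inter> ?N v = {w \<in> V. {u, w} \<in> E \<and> {v, w} \<in> E}" by blast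
  finally have *: "2 * min_degree V E
      \<le> card (?N u \<union> ?N v) + card {w \<in> V. {u, w} \<in> E \<and> {v, w} \<in> E}" .
  have "{v, u} \<notin> E" using assms by (simp add: insert_commute)
  then have "?N u \<union> ?N v \<subseteq> V - {u, v}"
    using assms edge_neq by blast
  then have "card (?N u \<union> ?N v) \<le> card (V - {u, v})"
    using finite_vertices by (intro card_mono) auto
  moreover have "card (V - {u, v}) + 2 = card V"
    using assms card_mono[OF finite_vertices, of "{u, v}"] finite_vertices
    by (simp add: card_Diff_subset)
  ultimately show ?thesis using * by linarith
qed

lemma rainbow_connected_if_two_paths:
  assumes "\<And>u v. \<lbrakk>u \<in> V; v \<in> V; u \<noteq> v; {u, v} \<notin> E\<rbrakk> \<Longrightarrow>
    \<exists>w\<in>V. {u, w} \<in> E \<and> {v, w} \<in> E \<and> c {u, w} \<noteq> c {v, w}"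
  shows "rainbow_connected V E c"
  unfolding rainbow_connected_def
proof (intro ballI impI)
  fix u v assume uv: "u \<in> V" "v \<in> V" "u \<noteq> v"
  show "\<exists>p. is_path V E u p v \<and> distinct (map c (path_edges p))"
  proof (cases "{u, v} \<in> E")
    case True
    then show ?thesis using uv
      by (intro exI[of _ "[u, v]"]) (simp add: is_path_def path_edges_def)
  next
    case False
    then obtain w where "w \<in> V" "{u, w} \<in> E" "{v, w} \<in> E" "c {u, w} \<noteq> c {v, w}"
      using assms uv by blast
    moreover from this have "u \<noteq> w" "w \<noteq> v" "{w, v} = {v, w}" using edge_neq by auto
    ultimately show ?thesis using uv
      by (intro exI[of _ "[u, w, v]"]) (simp add: is_path_def path_edges_def)
  qed
qed

text \<open>
  With at least \<open>2 log\<^sub>k n\<close> common neighbors, the paths of length two between the two vertices of a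
  non-adjacent pair are all monochromatic with probability at most \<open>1 / n\<^sup>2\<close> under a uniformly
  random coloring, and the union bound over the pairs applies.
\<close>

lemma rainbow_connection_number_le_if_common_neighbors:
  assumes "k > 0"
    and many: "\<And>u v. \<lbrakk>u \<in> V; v \<in> V; u \<noteq> v; {u, v} \<notin> E\<rbrakk> \<Longrightarrow>
      (card V)\<^sup>2 \<le> k ^ card {w \<in> V. {u, w} \<in> E \<and> {v, w} \<in> E}"
  shows "rainbow_connection_number V E \<le> enat k"
proof (cases "V = {}")
  case True
  then have "E = {}" using edges_wf by fastforce
  with True show ?thesis
    by (auto simp: rainbow_connection_number_le_iff rainbow_connected_def)
next
  case False
  define W where "W = (\<lambda>(u, v). {w \<in> V. {u, w} \<in> E \<and> {v, w} \<in> E})"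
  define I where "I = {(u, v). u \<in> V \<and> v \<in> V \<and> u \<noteq> v \<and> {u, v} \<notin> E}"
  define bad where "bad = (\<lambda>(u, v). {c \<in> E \<rightarrow>\<^sub>E {..<k}. \<forall>w\<in>W (u, v). c {u, w} = c {v, w}})"
  \<comment> \<open>The inclusion is strict because a diagonal pair is never in \<open>I\<close>.\<close>
  have "I \<subset> V \<times> V" using False unfolding I_def by blast
  then have I: "finite I" "card I < (card V)\<^sup>2"
    using finite_vertices psubset_card_mono[of "V \<times> V" I]
    by (auto simp: card_cartesian_product power2_eq_square intro: finite_subset[of I "V \<times> V"])
  have "(card V)\<^sup>2 * card (bad i) \<le> card (E \<rightarrow>\<^sub>E {..<k})" if "i \<in> I" for i
  proof -
    obtain u v where i: "i = (u, v)" by fastforce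
    then have uv: "u \<in> V" "v \<in> V" "u \<noteq> v" "{u, v} \<notin> E" using that by (auto simp: I_def)
    have "(card V)\<^sup>2 * card (bad i) \<le> k ^ card (W i) * card (bad i)"
      using many[OF uv] by (simp add: W_def i)
    also have "\<dots> = card (bad i) * card {..<k} ^ card (W i)" by simp
    also have "\<dots> \<le> card {..<k} ^ card E"
      unfolding bad_def i prod.case
    proof (rule card_PiE_agreeing)
      show "inj_on (\<lambda>w. {u, w}) (W (u, v))" by (auto simp: inj_on_def doubleton_eq_iff)
      \<comment> \<open>A common edge of two such paths could only be the missing edge between \<open>u\<close> and \<open>v\<close>.\<close>
      show "(\<lambda>w. {u, w}) ` W (u, v) \<inter> (\<lambda>w. {v, w}) ` W (u, v) = {}"
        using uv by (auto simp: W_def doubleton_eq_iff)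
    qed (auto simp: W_def finite_edges)
    finally show ?thesis using finite_edges by (simp add: card_PiE)
  qed
  moreover have "E \<rightarrow>\<^sub>E {..<k} \<noteq> {}" "finite (E \<rightarrow>\<^sub>E {..<k})"
    using \<open>k > 0\<close> finite_edges by (auto simp: PiE_eq_empty_iff intro: finite_PiE)
  moreover have "bad i \<subseteq> E \<rightarrow>\<^sub>E {..<k}" for i by (auto simp: bad_def)
  ultimately obtain c where c: "c \<in> E \<rightarrow>\<^sub>E {..<k}" "\<forall>i\<in>I. c \<notin> bad i"
    using exists_avoiding_all[of "E \<rightarrow>\<^sub>E {..<k}" I "(card V)\<^sup>2" bad] I by blast
  have "rainbow_connected V E c"
  proof (rule rainbow_connected_if_two_paths)
    fix u v assume "u \<in> V" "v \<in> V" "u \<noteq> v" "{u, v} \<notin> E"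
    then have "c \<notin> bad (u, v)" using c(2) by (simp add: I_def)
    then show "\<exists>w\<in>V. {u, w} \<in> E \<and> {v, w} \<in> E \<and> c {u, w} \<noteq> c {v, w}"
      using c(1) unfolding bad_def W_def by blast
  qed
  moreover have "card (c ` E) \<le> k"
    using c card_mono[of "{..<k}" "c ` E"] by auto
  ultimately show ?thesis by (auto simp: rainbow_connection_number_le_iff)
qed

end

theorem theorem1p3:
  fixes V :: "'a set" and E :: "'a set set" and k :: nat
  assumes "k \<ge> 2"
    and "simple_graph V E"
    and "noncomplete V E"
    and "real (min_degree V E) \<ge> real (card V) / 2 - 1 + log (real k) (real (card V))"
  shows "rainbow_connection_number V E \<le> enat k"
proof -
  interpret simple_graph V E by fact
  have n: "card V > 0"
    using assms(3) finite_vertices by (auto simp: noncomplete_def card_gt_0_iff)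
  show ?thesis
  proof (rule rainbow_connection_number_le_if_common_neighbors)
    fix u v assume uv: "u \<in> V" "v \<in> V" "u \<noteq> v" "{u, v} \<notin> E"
    let ?m = "card {w \<in> V. {u, w} \<in> E \<and> {v, w} \<in> E}"
    have "real (2 * min_degree V E + 2) \<le> real (card V + ?m)"
      using card_common_neighbors[OF uv] by (rule of_nat_mono)
    then have "2 * log k (card V) \<le> ?m"
      using assms(4) by simp
    then have "log k ((card V)\<^sup>2) \<le> ?m"
      using n by (simp add: log_nat_power)
    then have "real ((card V)\<^sup>2) \<le> k powr ?m"
      using n assms(1) by (subst (asm) log_le_iff) auto
    also have "\<dots> = real (k ^ ?m)"
      using assms(1) by (simp add: powr_realpow)
    finally show "(card V)\<^sup>2 \<le> k ^ ?m" by (simp only: of_nat_le_iff)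
  qed (use assms(1) in simp)
qed

end
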